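(* Suppose that: (i) $f\equiv g\circ\mathcal{B}$, where $\mathcal{B}:\mathbb{E}_1\to\mathbb{E}_3$ is a linear mapping into a finite-dimensional Euclidean space $\mathbb{E}_3$ and $g:\mathbb{E}_3\to\mathbb{R}$ is $\alpha_g$-strongly convex, $\alpha_g>0$; and (ii) $\mathcal{R}_{\mathcal{Q}}(\mathbf{q})=\mathcal{R}_{\mathcal{X}}(\mathbf{x})+\mathcal{R}_{\mathcal{Y}}(\mathbf{y})$ is the indicator function of a compact convex polytope $\mathcal{F}=\{\mathbf{q}\in\mathbb{E}:\mathcal{C}\mathbf{q}\le\mathbf{b}\}$, where $\mathcal{C}:\mathbb{E}\to\mathbb{R}^p$ is a linear mapping and $\mathbf{b}\in\mathbb{R}^p$. Then there exists a constant $\sigma>0$ such that if $\rho\ge\alpha_g$, then the problem (OP) satisfies the Primal Quadratic Gap property (with penalty parameter $\rho$) with the parameter $\alpha_S=\alpha_g\sigma^{-1}$.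
   Context: Setting. $\mathbb{E}_1,\mathbb{E}_2$ are finite-dimensional Euclidean spaces, $\mathbb{E}=\mathbb{E}_1\times\mathbb{E}_2$, $f:\mathbb{E}_1\to\mathbb{R}$ is convex and $\beta$-smooth (differentiable with $\beta$-Lipschitz gradient), $\mathcal{R}_{\mathcal{X}}:\mathbb{E}_1\to(-\infty,\infty]$ and $\mathcal{R}_{\mathcal{Y}}:\mathbb{E}_2\to(-\infty,\infty]$ are proper, lower semicontinuous and convex, and $\mathcal{A}:\mathbb{E}_1\to\mathbb{E}_2$ is linear. The problem is $$\text{(OP)}\qquad \min_{\mathbf{x}\in\mathbb{E}_1,\mathbf{y}\in\mathbb{E}_2} f(\mathbf{x})+\mathcal{R}_{\mathcal{X}}(\mathbf{x})+\mathcal{R}_{\mathcal{Y}}(\mathbf{y})\quad\text{s.t.}\quad\mathcal{A}\mathbf{x}=\mathbf{y}.$$ Write $\mathbf{q}=(\mathbf{x},\mathbf{y})\in\mathbb{E}$, $\mathcal{R}_{\mathcal{Q}}(\mathbf{q})=\mathcal{R}_{\mathcal{X}}(\mathbf{x})+\mathcal{R}_{\mathcal{Y}}(\mathbf{y})$, $\mathcal{K}\mathbf{q}=\mathcal{A}\mathbf{x}-\mathbf{y}$. Norms are Euclidean. Let $\mathcal{P}^*$ be the set of optimal solutions of (OP). The indicator function of a set is $0$ on the set and $+\infty$ off it. For a penalty parameter $\rho>0$, $$\mathcal{L}_\rho(\mathbf{q},\mathbf{w})=f(\mathbf{x})+\mathcal{R}_{\mathcal{Q}}(\mathbf{q})+\langle\mathbf{w},\mathcal{K}\mathbf{q}\rangle+\tfrac{\rho}{2}\|\mathcal{K}\mathbf{q}\|^2,\qquad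 S(\mathbf{q},\mathbf{w})=f(\mathbf{x})+\langle\mathbf{w},\mathcal{K}\mathbf{q}\rangle+\tfrac{\rho}{2}\|\mathcal{K}\mathbf{q}\|^2.$$ Standing assumptions: (1) $\mathcal{L}_\rho$ (for the penalty parameter $\rho$ under consideration) has a saddle point, i.e. there is $(\mathbf{q}^*,\mathbf{w}^* )\in\mathbb{E}\times\mathbb{E}_2$ with $\mathcal{L}_\rho(\mathbf{q}^*,\mathbf{w})\le\mathcal{L}_\rho(\mathbf{q}^*,\mathbf{w}^* )\le\mathcal{L}_\rho(\mathbf{q},\mathbf{w}^* )$ for all $\mathbf{q}\in\mathbb{E},\mathbf{w}\in\mathbb{E}_2$; (2) (Slater) there exist $\mathbf{x}\in\mathrm{ri}(\mathrm{dom} f\cap\mathrm{dom}\,\mathcal{R}_{\mathcal{X}})$ and $\mathbf{y}\in\mathrm{ri}(\mathrm{dom}\,\mathcal{R}_{\mathcal{Y}})$ with $\mathcal{A}\mathbf{x}=\mathbf{y}$, where ri denotes relative interior. Primal Quadratic Gap (PQG). (OP) satisfies PQG with parameter $\alpha_S>0$ if for every $\mathbf{q}\in\mathrm{dom}(\mathcal{R}_{\mathcal{Q}})$, the point $\mathbf{q}^*=\arg\min_{\mathbf{p}\in\mathcal{P}^*}\|\mathbf{q}-\mathbf{p}\|^2$ satisfies, for all $\mathbf{w}\in\mathbb{E}_2$, $$\langle\mathbf{q}^*-\mathbf{q},\nabla_{\mathbf{q}}S(\mathbf{q},\mathbf{w})\rangle\le S(\mathbf{q}^*,\mathbf{w})-S(\mathbf{q},\mathbf{w})-\tfrac{\alpha_S}{2}\|\mathbf{q}^*-\mathbf{q}\|^2.$$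 *)

theory Defs
  imports "HOL-Analysis.Analysis"
begin

section \<open>Extended-real-valued convex functions\<close>

definition effective_domain :: "('a \<Rightarrow> ereal) \<Rightarrow> 'a set" where
  "effective_domain R = {x. R x < \<infinity>}"

definition proper :: "('a \<Rightarrow> ereal) \<Rightarrow> bool" where
  "proper R \<longleftrightarrow> (\<forall>x. R x \<noteq> -\<infinity>) \<and> effective_domain R \<noteq> {}"

definition lower_semicontinuous :: "('a::topological_space \<Rightarrow> ereal) \<Rightarrow> bool" where
  "lower_semicontinuous R \<longleftrightarrow> (\<forall>x. R x \<le> Liminf (at x) R)"

text \<open>Only used for functions that never take the value \<open>-\<infinity>\<close>. The weights may be \<open>0\<close>,
  which is harmless because \<open>0 * \<infinity> = 0\<close> in \<^typ>\<open>ereal\<close>.\<close>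

definition convex_ereal :: "('a::real_vector \<Rightarrow> ereal) \<Rightarrow> bool" where
  "convex_ereal R \<longleftrightarrow>
    (\<forall>x y. \<forall>u\<ge>0. \<forall>v\<ge>0. u + v = 1 \<longrightarrow>
      R (u *\<^sub>R x + v *\<^sub>R y) \<le> ereal u * R x + ereal v * R y)"

definition indicator_ereal :: "'a set \<Rightarrow> 'a \<Rightarrow> ereal" where
  "indicator_ereal F q = (if q \<in> F then 0 else \<infinity>)"


section \<open>Gradients, smoothness and strong convexity\<close>

definition grad :: "('a::real_inner \<Rightarrow> real) \<Rightarrow> 'a \<Rightarrow> 'a" where
  "grad h x = (THE D. GDERIV h x :> D)"

definition smooth_with :: "real \<Rightarrow> ('a::real_inner \<Rightarrow> real) \<Rightarrow> bool" where
  "smooth_with \<beta> h \<longleftrightarrow> (\<forall>x. \<exists>D. GDERIV h x :> D) \<and> \<beta>-lipschitz_on UNIV (grad h)"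

definition strongly_convex :: "real \<Rightarrow> ('a::real_normed_vector \<Rightarrow> real) \<Rightarrow> bool" where
  "strongly_convex \<alpha> g \<longleftrightarrow>
    (\<forall>x y. \<forall>u\<ge>0. \<forall>v\<ge>0. u + v = 1 \<longrightarrow>
      g (u *\<^sub>R x + v *\<^sub>R y) \<le> u * g x + v * g y - \<alpha> / 2 * u * v * (norm (x - y))\<^sup>2)"


section \<open>The linearly constrained composite problem\<close>

definition R_Q :: "('a \<Rightarrow> ereal) \<Rightarrow> ('b \<Rightarrow> ereal) \<Rightarrow> 'a \<times> 'b \<Rightarrow> ereal" where
  "R_Q R\<^sub>X R\<^sub>Y q = R\<^sub>X (fst q) + R\<^sub>Y (snd q)"

definition K_op :: "('a \<Rightarrow> 'b::real_vector) \<Rightarrow> 'a \<times> 'b \<Rightarrow> 'b" where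
  "K_op A q = A (fst q) - snd q"

definition objective ::
  "('a \<Rightarrow> real) \<Rightarrow> ('a \<Rightarrow> ereal) \<Rightarrow> ('b \<Rightarrow> ereal) \<Rightarrow> 'a \<times> 'b \<Rightarrow> ereal" where
  "objective f R\<^sub>X R\<^sub>Y q = ereal (f (fst q)) + R_Q R\<^sub>X R\<^sub>Y q"

text \<open>Optimal solutions are required to have finite objective value, so that a problem without
  feasible point in the domain of the objective has no optimal solution.\<close>

definition optimal_solutions ::
  "('a \<Rightarrow> real) \<Rightarrow> ('a \<Rightarrow> ereal) \<Rightarrow> ('b \<Rightarrow> ereal) \<Rightarrow> ('a \<Rightarrow> 'b) \<Rightarrow> ('a \<times> 'b) set" where
  "optimal_solutions f R\<^sub>X R\<^sub>Y A =
    {(x, y). A x = y \<and> objective f R\<^sub>X R\<^sub>Y (x, y) < \<infinity> \<and>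
      (\<forall>x' y'. A x' = y' \<longrightarrow> objective f R\<^sub>X R\<^sub>Y (x, y) \<le> objective f R\<^sub>X R\<^sub>Y (x', y'))}"

definition S_fun ::
  "('a \<Rightarrow> real) \<Rightarrow> ('a \<Rightarrow> 'b::real_inner) \<Rightarrow> real \<Rightarrow> 'a \<times> 'b \<Rightarrow> 'b \<Rightarrow> real" where
  "S_fun f A \<rho> q w = f (fst q) + w \<bullet> K_op A q + \<rho> / 2 * (norm (K_op A q))\<^sup>2"

definition aug_Lagrangian ::
  "('a \<Rightarrow> real) \<Rightarrow> ('a \<Rightarrow> ereal) \<Rightarrow> ('b \<Rightarrow> ereal) \<Rightarrow> ('a \<Rightarrow> 'b::real_inner) \<Rightarrow> real
    \<Rightarrow> 'a \<times> 'b \<Rightarrow> 'b \<Rightarrow> ereal" where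
  "aug_Lagrangian f R\<^sub>X R\<^sub>Y A \<rho> q w =
    ereal (f (fst q)) + R_Q R\<^sub>X R\<^sub>Y q + ereal (w \<bullet> K_op A q)
      + ereal (\<rho> / 2 * (norm (K_op A q))\<^sup>2)"

definition has_saddle_point :: "('q \<Rightarrow> 'w \<Rightarrow> ereal) \<Rightarrow> bool" where
  "has_saddle_point L \<longleftrightarrow>
    (\<exists>q\<^sub>0 w\<^sub>0. \<forall>q w. L q\<^sub>0 w \<le> L q\<^sub>0 w\<^sub>0 \<and> L q\<^sub>0 w\<^sub>0 \<le> L q w\<^sub>0)"

definition slater ::
  "('a::euclidean_space \<Rightarrow> real) \<Rightarrow> ('a \<Rightarrow> ereal) \<Rightarrow> ('b::euclidean_space \<Rightarrow> ereal)
    \<Rightarrow> ('a \<Rightarrow> 'b) \<Rightarrow> bool" where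
  "slater f R\<^sub>X R\<^sub>Y A \<longleftrightarrow>
    (\<exists>x \<in> rel_interior (effective_domain (\<lambda>x. ereal (f x)) \<inter> effective_domain R\<^sub>X).
      \<exists>y \<in> rel_interior (effective_domain R\<^sub>Y). A x = y)"

text \<open>The projection onto the set of optimal solutions is required to exist and to be unique.\<close>

definition PQG ::
  "('a::real_inner \<Rightarrow> real) \<Rightarrow> ('a \<Rightarrow> ereal) \<Rightarrow> ('b::real_inner \<Rightarrow> ereal) \<Rightarrow> ('a \<Rightarrow> 'b)
    \<Rightarrow> real \<Rightarrow> real \<Rightarrow> bool" where
  "PQG f R\<^sub>X R\<^sub>Y A \<rho> \<alpha> \<longleftrightarrow> \<alpha> > 0 \<and>
    (\<forall>q \<in> effective_domain (R_Q R\<^sub>X R\<^sub>Y).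
      \<exists>q\<^sub>0. {p. is_arg_min (\<lambda>p. (norm (q - p))\<^sup>2) (\<lambda>p. p \<in> optimal_solutions f R\<^sub>X R\<^sub>Y A) p} = {q\<^sub>0} \<and>
        (\<forall>w. (q\<^sub>0 - q) \<bullet> grad (\<lambda>p. S_fun f A \<rho> p w) q
              \<le> S_fun f A \<rho> q\<^sub>0 w - S_fun f A \<rho> q w - \<alpha> / 2 * (norm (q\<^sub>0 - q))\<^sup>2))"

end

theory Submission
  imports Defs
begin

text \<open>
  Strong convexity of \<open>g\<close> forces \<open>\<B> x\<close> to take one and the same value \<open>t\<close> at all optimal solutions
  (otherwise the midpoint of two of them would be better), while conversely \<open>f = g \<circ> \<B>\<close> depends on
  \<open>\<B> x\<close> only.  Hence the solution set is cut out of the polytope by linear \<^emph>\<open>equations\<close>: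
  it is \<open>{q \<in> F. \<E> q = (t, 0)}\<close> with \<open>\<E> q = (\<B> x, \<K> q)\<close>
  (lemma \<open>optimal_solutions_eq_affine_slice\<close>).

  Hoffman's error bound (lemma \<open>hoffman_bound\<close>) now bounds the distance from \<open>q \<in> F\<close> to its projection
  \<open>q\<^sub>0\<close> on the solution set by \<open>\<kappa> \<parallel>\<E> q - \<E> q\<^sub>0\<parallel>\<close>, with \<open>\<kappa>\<close> depending only on the linear maps, in particular
  not on \<open>\<rho>\<close>.  On the other hand the linearisation error of \<open>S(\<cdot>, w)\<close> between \<open>q\<close> and \<open>q\<^sub>0\<close> is free
  of \<open>w\<close>, because the term with \<open>w\<close> is linear in \<open>q\<close>; the part from \<open>f\<close> is at least
  \<open>\<alpha>\<^sub>g / 2 \<parallel>\<B> (x\<^sub>0 - x)\<parallel>\<^sup>2\<close> (lemma \<open>strongly_convex_compose_gradient\<close>) and the penalty contributes exactly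
  \<open>\<rho> / 2 \<parallel>\<K> (q\<^sub>0 - q)\<parallel>\<^sup>2\<close>.  As \<open>\<rho> \<ge> \<alpha>\<^sub>g\<close>, the error is at least \<open>\<alpha>\<^sub>g / 2 \<parallel>\<E> (q\<^sub>0 - q)\<parallel>\<^sup>2\<close>, so that \<open>\<sigma> = \<kappa>\<^sup>2\<close> works.
\<close>

section \<open>Hoffman's error bound\<close>

text \<open>
  Two local facts carry Hoffman's bound.  Let \<open>p\<close> be the projection of \<open>q\<close> on the polyhedron and \<open>I\<close> the set
  of inequalities active at \<open>p\<close>.  Then \<open>d = q - p\<close> does not increase any constraint in \<open>I\<close>, and it makes
  no acute angle with any direction \<open>v\<close> that is feasible to first order at \<open>p\<close>.  This set of candidate
  residuals \<open>d\<close> depends on \<open>I\<close> only, and there are finitely many \<open>I\<close>.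
\<close>

definition residual_cone ::
  "('q::real_inner \<Rightarrow> real ^ 'p) \<Rightarrow> ('q \<Rightarrow> 'r::real_vector) \<Rightarrow> 'p set \<Rightarrow> 'q set" where
  "residual_cone C E I = {d. (\<forall>i\<in>I. C d $ i \<le> 0) \<and>
     (\<forall>v. (\<forall>i\<in>I. C v $ i \<le> 0) \<longrightarrow> E v = 0 \<longrightarrow> d \<bullet> v \<le> 0)}"

lemma closed_residual_cone:
  fixes C :: "'q::euclidean_space \<Rightarrow> real ^ 'p::finite"
  assumes "linear C"
  shows "closed (residual_cone C E I)"
proof -
  have "continuous_on UNIV C"
    using assms by (simp add: linear_continuous_on linear_linear)
  then have "closed {d. C d $ i \<le> 0}" for i
    by (intro closed_Collect_le continuous_intros) auto
  moreover have "closed {d::'q. d \<bullet> v \<le> 0}" for v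
    by (intro closed_Collect_le continuous_intros)
  moreover have "residual_cone C E I = (\<Inter>i\<in>I. {d. C d $ i \<le> 0}) \<inter>
      (\<Inter>v\<in>{v. (\<forall>i\<in>I. C v $ i \<le> 0) \<and> E v = 0}. {d. d \<bullet> v \<le> 0})"
    by (auto simp: residual_cone_def)
  ultimately show ?thesis
    by (simp add: closed_INT closed_Int)
qed

text \<open>
  A residual \<open>d\<close> with \<open>E d = 0\<close> is itself a feasible direction, whence \<open>d \<bullet> d \<le> 0\<close>.
  So \<open>E\<close> has no zero among the residuals of unit length, and these form a compact set.
\<close>

lemma residual_cone_bound:
  fixes C :: "'q::euclidean_space \<Rightarrow> real ^ 'p::finite" and E :: "'q \<Rightarrow> 'r::euclidean_space"
  assumes C: "linear C" and E: "linear E"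
  obtains \<kappa> where "\<kappa> > 0" "\<And>d. d \<in> residual_cone C E I \<Longrightarrow> norm d \<le> \<kappa> * norm (E d)"
proof -
  let ?D = "residual_cone C E I \<inter> sphere 0 1"
  have "compact ?D"
    by (simp add: closed_Int_compact closed_residual_cone C)
  moreover have "continuous_on ?D (\<lambda>d. norm (E d))"
    using E by (intro continuous_on_norm) (simp add: linear_continuous_on linear_linear)
  moreover have pos: "norm (E d) > 0" if "d \<in> ?D" for d
  proof -
    have "d \<bullet> d \<le> 0" if "E d = 0"
      using \<open>d \<in> ?D\<close> that by (simp add: residual_cone_def)
    moreover have "d \<bullet> d = 1"
      using that by (simp flip: power2_norm_eq_inner)
    ultimately show ?thesis
      by auto
  qed
  ultimately obtain m where m: "m > 0" "\<And>d. d \<in> ?D \<Longrightarrow> m \<le> norm (E d)"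
  proof (cases "?D = {}")
    case False
    then obtain d0 where "d0 \<in> ?D" "\<forall>d\<in>?D. norm (E d0) \<le> norm (E d)"
      using continuous_attains_inf \<open>compact ?D\<close> \<open>continuous_on ?D _\<close> by metis
    with pos that show ?thesis by blast
  next
    \<comment> \<open>The cone is \<open>{0}\<close>; any \<open>m\<close> will do.\<close>
    case True
    with that[of 1] show ?thesis by auto
  qed
  have "norm d \<le> inverse m * norm (E d)" if d: "d \<in> residual_cone C E I" for d
  proof (cases "d = 0")
    case False
    then have "(1 / norm d) *\<^sub>R d \<in> ?D"
      using d by (auto simp: residual_cone_def linear_scale[OF C] divide_le_0_iff)
    from m(2)[OF this] show ?thesis
      using False \<open>m > 0\<close> by (simp add: linear_scale[OF E] field_simps)
  qed (use \<open>m > 0\<close> in simp)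
  with \<open>m > 0\<close> show thesis
    using that[of "inverse m"] by simp
qed

lemma convex_atMost_vec: "convex {..b :: real ^ 'p}"
  unfolding convex_alt by (auto simp: less_eq_vec_def intro!: convex_bound_le)

lemma projection_residual_in_cone:
  fixes C :: "'q::euclidean_space \<Rightarrow> real ^ 'p::finite" and E :: "'q \<Rightarrow> 'r::euclidean_space"
  assumes C: "linear C" and E: "linear E"
    and q: "C q \<le> b" and p: "C p \<le> b" "E p = e"
    and closest: "\<And>z. C z \<le> b \<Longrightarrow> E z = e \<Longrightarrow> dist q p \<le> dist q z"
  shows "q - p \<in> residual_cone C E {i. C p $ i = b $ i}"
  unfolding residual_cone_def
proof (intro CollectI conjI ballI allI impI)
  show "C (q - p) $ i \<le> 0" if "i \<in> {i. C p $ i = b $ i}" for i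
    using that q by (simp add: linear_diff[OF C] less_eq_vec_def)
next
  fix v
  assume v: "\<forall>i\<in>{i. C p $ i = b $ i}. C v $ i \<le> 0" and Ev: "E v = 0"
  \<comment> \<open>An inactive inequality survives a short step along \<open>v\<close>; an active one survives any step.\<close>
  have "\<forall>\<^sub>F t in at_right 0. C (p + t *\<^sub>R v) $ i \<le> b $ i" for i
  proof (cases "C p $ i = b $ i")
    case True
    with v have "C (p + t *\<^sub>R v) $ i \<le> b $ i" if "t > 0" for t
      using that by (simp add: linear_add[OF C] linear_scale[OF C] mult_le_0_iff)
    then show ?thesis
      by (auto simp: eventually_at_right_less intro: eventually_mono[OF eventually_at_right_less])
  next
    case False
    with p(1) have "C p $ i + 0 * C v $ i < b $ i"
      by (simp add: less_eq_vec_def order_less_le)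
    moreover have "((\<lambda>t. C p $ i + t * C v $ i) \<longlongrightarrow> C p $ i + 0 * C v $ i) (at_right 0)"
      by (intro tendsto_intros)
    ultimately have "\<forall>\<^sub>F t in at_right 0. C p $ i + t * C v $ i < b $ i"
      by (rule order_tendstoD(2)[rotated])
    then show ?thesis
      by eventually_elim (simp add: linear_add[OF C] linear_scale[OF C])
  qed
  then have "\<forall>\<^sub>F t in at_right (0::real). \<forall>i. C (p + t *\<^sub>R v) $ i \<le> b $ i"
    by (rule eventually_all_finite)
  then have "\<forall>\<^sub>F t in at_right 0. t > 0 \<and> (\<forall>i. C (p + t *\<^sub>R v) $ i \<le> b $ i)"
    using eventually_at_right_less[of "0::real"] by eventually_elim auto
  then obtain t where t: "t > 0" "C (p + t *\<^sub>R v) \<le> b"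
    unfolding less_eq_vec_def
    by (metis (mono_tags, lifting) eventually_happens' trivial_limit_at_right_real)
  let ?P = "{z. C z \<le> b \<and> E z = e}"
  have "?P = C -` {..b} \<inter> E -` {e}"
    by auto
  then have "convex ?P"
    using C E by (simp add: convex_Int convex_linear_vimage convex_atMost_vec)
  moreover have "closed ?P"
  proof -
    have "continuous_on UNIV C" "continuous_on UNIV E"
      using C E by (simp_all add: linear_continuous_on linear_linear)
    then show ?thesis
      unfolding less_eq_vec_def
      by (intro closed_Collect_conj closed_Collect_all closed_Collect_le closed_Collect_eq
            continuous_intros) auto
  qed
  moreover have "p + t *\<^sub>R v \<in> ?P"
    using t p Ev by (simp add: linear_add[OF E] linear_scale[OF E])
  ultimately have "(q - p) \<bullet> (p + t *\<^sub>R v - p) \<le> 0"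
    using p closest by (intro any_closest_point_dot[of ?P]) auto
  with \<open>t > 0\<close> show "(q - p) \<bullet> v \<le> 0"
    by (simp add: mult_le_0_iff)
qed

text \<open>
  The constant serves all right-hand sides \<open>b\<close> and \<open>e\<close> at once, since the cones of
  residuals involve only \<open>C\<close>, \<open>E\<close> and the active set.
\<close>

lemma hoffman_bound:
  fixes C :: "'q::euclidean_space \<Rightarrow> real ^ 'p::finite" and E :: "'q \<Rightarrow> 'r::euclidean_space"
  assumes C: "linear C" and E: "linear E"
  obtains \<kappa> where "\<kappa> > 0"
    "\<And>b e q p. C q \<le> b \<Longrightarrow> C p \<le> b \<Longrightarrow> E p = e \<Longrightarrow>
      (\<And>z. C z \<le> b \<Longrightarrow> E z = e \<Longrightarrow> dist q p \<le> dist q z) \<Longrightarrow>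
      norm (q - p) \<le> \<kappa> * norm (E (q - p))"
proof -
  have "\<exists>\<kappa>>0. \<forall>d\<in>residual_cone C E I. norm d \<le> \<kappa> * norm (E d)" for I
    using residual_cone_bound[OF C E, of I] by metis
  then obtain k where k: "\<And>I. k I > 0"
    "\<And>I d. d \<in> residual_cone C E I \<Longrightarrow> norm d \<le> k I * norm (E d)"
    by metis
  define \<kappa> where "\<kappa> = Max (range k)"
  have le: "k I \<le> \<kappa>" for I
    by (simp add: \<kappa>_def)
  have pos: "\<kappa> > 0"
    using k(1) le by (meson order_less_le_trans)
  have bound: "norm (q - p) \<le> \<kappa> * norm (E (q - p))"
    if q: "C q \<le> b" and p: "C p \<le> b" "E p = e"
      and closest: "\<And>z. C z \<le> b \<Longrightarrow> E z = e \<Longrightarrow> dist q p \<le> dist q z" for b e q p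
  proof -
    have "norm (q - p) \<le> k {i. C p $ i = b $ i} * norm (E (q - p))"
      by (rule k(2)) (rule projection_residual_in_cone[OF C E q p closest])
    also have "\<dots> \<le> \<kappa> * norm (E (q - p))"
      by (intro mult_right_mono le) simp
    finally show ?thesis .
  qed
  show thesis
    by (rule that[OF pos]) (rule bound)
qed

section \<open>First-order information\<close>

lemma GDERIV_grad:
  fixes h :: "'a::real_inner \<Rightarrow> real"
  assumes "GDERIV h x :> D"
  shows "grad h x = D"
  unfolding grad_def
proof (rule the_equality[where P = "\<lambda>D. GDERIV h x :> D", OF assms])
  fix D'
  assume "GDERIV h x :> D'"
  then have "(\<lambda>v. v \<bullet> D') = (\<lambda>v. v \<bullet> D)"
    using assms unfolding gderiv_def by (rule has_derivative_unique)
  then show "D' = D"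
    by (metis vector_eq_ldot)
qed

text \<open>The gradient exists because the Riesz representative of the derivative \<open>L\<close> is \<open>adjoint L 1\<close>.\<close>

lemma inner_grad_eq_derivative:
  fixes h :: "'a::euclidean_space \<Rightarrow> real"
  assumes "(h has_derivative L) (at x)"
  shows "v \<bullet> grad h x = L v"
proof -
  have L: "L v = v \<bullet> adjoint L 1" for v
    using adjoint_works[of L v 1] assms by (simp add: has_derivative_linear)
  then have "GDERIV h x :> adjoint L 1"
    using assms by (simp add: gderiv_def flip: L)
  then show ?thesis
    using L by (simp add: GDERIV_grad)
qed

text \<open>
  Divide the strong convexity inequality on the segment from \<open>x\<close> to \<open>y\<close> by the step length and let the step
  tend to \<open>0\<close>.  The argument uses a derivative of the composition \<open>g \<circ> B\<close> only, as \<open>g\<close> itself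
  may fail to be differentiable in directions outside the range of \<open>B\<close>.
\<close>

lemma strongly_convex_compose_gradient:
  fixes B :: "'a::real_inner \<Rightarrow> 'c::real_normed_vector"
  assumes g: "strongly_convex \<alpha> g" and B: "linear B"
    and D: "GDERIV (g \<circ> B) x :> D"
  shows "g (B x) + (y - x) \<bullet> D + \<alpha> / 2 * (norm (B (y - x)))\<^sup>2 \<le> g (B y)"
proof -
  let ?f = "g \<circ> B" and ?N = "(norm (B (y - x)))\<^sup>2"
  let ?\<phi> = "\<lambda>t. ?f (x + t *\<^sub>R (y - x))"
  have "(?\<phi> has_derivative (\<lambda>t. (t *\<^sub>R (y - x)) \<bullet> D)) (at 0)"
  proof (rule has_derivative_compose[of "\<lambda>t. x + t *\<^sub>R (y - x)" _ 0 UNIV ?f])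
    show "((\<lambda>t. x + t *\<^sub>R (y - x)) has_derivative (\<lambda>t. t *\<^sub>R (y - x))) (at 0)"
      by (auto intro!: derivative_eq_intros)
    show "(?f has_derivative (\<lambda>h. h \<bullet> D)) (at (x + 0 *\<^sub>R (y - x)))"
      using D by (simp add: gderiv_def)
  qed
  then have "(?\<phi> has_field_derivative (y - x) \<bullet> D) (at 0)"
    by (rule has_derivative_imp_has_field_derivative) simp
  then have "(?\<phi> has_field_derivative (y - x) \<bullet> D) (at 0 within {0<..})"
    by (rule has_field_derivative_at_within)
  then have lim: "((\<lambda>t. (?\<phi> t - ?f x) / t) \<longlongrightarrow> (y - x) \<bullet> D) (at_right 0)"
    by (simp add: has_field_derivative_iff)
  have "((\<lambda>t. ?f y - ?f x - \<alpha> / 2 * (1 - t) * ?N)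
      \<longlongrightarrow> ?f y - ?f x - \<alpha> / 2 * (1 - 0) * ?N) (at_right (0::real))"
    by (intro tendsto_intros)
  moreover have "\<forall>\<^sub>F t in at_right 0. (?\<phi> t - ?f x) / t \<le> ?f y - ?f x - \<alpha> / 2 * (1 - t) * ?N"
    unfolding eventually_at_right_field
  proof (intro exI[of _ 1] conjI allI impI)
    fix t :: real
    assume t: "0 < t" "t < 1"
    have "?\<phi> t = g (t *\<^sub>R B y + (1 - t) *\<^sub>R B x)"
      by (simp add: linear_add[OF B] linear_diff[OF B] linear_scale[OF B] algebra_simps)
    also have "\<dots> \<le> t * ?f y + (1 - t) * ?f x - \<alpha> / 2 * t * (1 - t) * ?N"
      using g t unfolding strongly_convex_def by (simp add: linear_diff[OF B])
    finally have "?\<phi> t - ?f x \<le> (?f y - ?f x - \<alpha> / 2 * (1 - t) * ?N) * t"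
      by (simp add: algebra_simps)
    with t show "(?\<phi> t - ?f x) / t \<le> ?f y - ?f x - \<alpha> / 2 * (1 - t) * ?N"
      by (simp add: pos_divide_le_eq)
  qed simp
  ultimately have "(y - x) \<bullet> D \<le> ?f y - ?f x - \<alpha> / 2 * (1 - 0) * ?N"
    using lim by (intro tendsto_le[of "at_right (0::real)"]) auto
  then show ?thesis
    by simp
qed

section \<open>The problem data\<close>

lemma linear_K_op:
  assumes "linear A"
  shows "linear (K_op A)"
  by (rule linearI)
    (simp_all add: K_op_def linear_add[OF assms] linear_scale[OF assms] algebra_simps)

text \<open>
  The linearisation error of \<open>S\<close> splits into that of \<open>f\<close> and that of the quadratic penalty, for which it is exact;
  the linear term \<open>w \<bullet> K_op A q\<close> drops out.
\<close>

lemma S_fun_linearisation_error: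
  fixes f :: "'a::euclidean_space \<Rightarrow> real" and A :: "'a \<Rightarrow> 'b::euclidean_space"
  assumes A: "linear A" and D: "GDERIV f (fst q) :> D"
  shows "S_fun f A \<rho> q' w - S_fun f A \<rho> q w - (q' - q) \<bullet> grad (\<lambda>p. S_fun f A \<rho> p w) q
    = (f (fst q') - f (fst q) - (fst q' - fst q) \<bullet> D) + \<rho> / 2 * (norm (K_op A (q' - q)))\<^sup>2"
proof -
  note K = linear_K_op[OF A]
  have dK: "(K_op A has_derivative K_op A) (at q)"
    using K by (simp add: linear_imp_has_derivative)
  have "((\<lambda>p. f (fst p)) has_derivative (\<lambda>v. fst v \<bullet> D)) (at q)"
    using D unfolding gderiv_def
    by (intro has_derivative_compose[of fst fst q UNIV f]) (auto intro!: derivative_eq_intros)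
  then have "((\<lambda>p. S_fun f A \<rho> p w) has_derivative
      (\<lambda>v. fst v \<bullet> D + w \<bullet> K_op A v + \<rho> * (K_op A q \<bullet> K_op A v))) (at q)"
    unfolding S_fun_def power2_norm_eq_inner
    by (auto intro!: derivative_eq_intros dK simp: inner_commute algebra_simps)
  from inner_grad_eq_derivative[OF this, of "q' - q"] show ?thesis
    unfolding S_fun_def power2_norm_eq_inner
    by (simp add: linear_diff[OF K] inner_diff inner_commute algebra_simps)
qed

text \<open>
  Compactness and the feasible point \<open>q\<^sub>1\<close> provide a minimiser.
  The midpoint of two minimisers is feasible, so strong convexity of \<open>g\<close> makes their images under \<open>B\<close>
  coincide; and the objective is constant where \<open>B\<close> is.
\<close>

lemma optimal_solutions_eq_affine_slice:
  fixes A :: "'a::euclidean_space \<Rightarrow> 'b::euclidean_space" and B :: "'a \<Rightarrow> 'c::real_normed_vector"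
  assumes F: "compact F" "convex F" and RQ: "R_Q R\<^sub>X R\<^sub>Y = indicator_ereal F"
    and A: "linear A" and B: "linear B"
    and g: "\<alpha> > 0" "strongly_convex \<alpha> g" and cont: "continuous_on UNIV (g \<circ> B)"
    and feasible: "q\<^sub>1 \<in> F" "K_op A q\<^sub>1 = 0"
  obtains t where "optimal_solutions (g \<circ> B) R\<^sub>X R\<^sub>Y A = {q \<in> F. B (fst q) = t \<and> K_op A q = 0}"
    and "{q \<in> F. B (fst q) = t \<and> K_op A q = 0} \<noteq> {}"
proof -
  note K = linear_K_op[OF A]
  let ?G = "{q \<in> F. K_op A q = 0}"
  have "objective (g \<circ> B) R\<^sub>X R\<^sub>Y q = (if q \<in> F then ereal (g (B (fst q))) else \<infinity>)" for q
    by (simp add: objective_def RQ indicator_ereal_def)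
  then have opt: "optimal_solutions (g \<circ> B) R\<^sub>X R\<^sub>Y A
      = {q \<in> ?G. \<forall>q'\<in>?G. g (B (fst q)) \<le> g (B (fst q'))}"
    unfolding optimal_solutions_def by (auto simp: K_op_def split: if_splits)
  have "closed {q. K_op A q = 0}"
    using K by (intro closed_Collect_eq continuous_on_const)
      (simp add: linear_continuous_on linear_linear)
  moreover have "?G = F \<inter> {q. K_op A q = 0}"
    by auto
  ultimately have "compact ?G"
    using F(1) by (simp add: compact_Int_closed)
  moreover have "continuous_on ?G (\<lambda>q. g (B (fst q)))"
    using continuous_on_compose2[OF cont, of ?G fst] by (simp add: continuous_on_fst)
  ultimately obtain q0 where q0: "q0 \<in> ?G" "\<And>q. q \<in> ?G \<Longrightarrow> g (B (fst q0)) \<le> g (B (fst q))"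
    using continuous_attains_inf[of ?G "\<lambda>q. g (B (fst q))"] feasible by blast
  have unique: "B (fst q) = B (fst q0)" if q: "q \<in> ?G" "g (B (fst q)) \<le> g (B (fst q0))" for q
  proof -
    let ?m = "(1/2) *\<^sub>R q0 + (1/2) *\<^sub>R q"
    have "?m \<in> ?G"
      using q q0 convexD[OF F(2), of q0 q "1/2" "1/2"]
      by (simp add: linear_add[OF K] linear_scale[OF K])
    then have "g (B (fst q0)) \<le> g (B (fst ?m))"
      by (rule q0(2))
    also have "\<dots> = g ((1/2) *\<^sub>R B (fst q0) + (1/2) *\<^sub>R B (fst q))"
      by (simp add: linear_add[OF B] linear_scale[OF B])
    also have "\<dots> \<le> 1/2 * g (B (fst q0)) + 1/2 * g (B (fst q))
        - \<alpha> / 2 * (1/2) * (1/2) * (norm (B (fst q0) - B (fst q)))\<^sup>2"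
      using g(2)[unfolded strongly_convex_def, rule_format, of "1/2" "1/2"] by simp
    finally have "\<alpha> * (norm (B (fst q0) - B (fst q)))\<^sup>2 \<le> 0"
      using q(2) by simp
    with g(1) show ?thesis
      by (simp add: mult_le_0_iff)
  qed
  have "(\<forall>q'\<in>?G. g (B (fst q)) \<le> g (B (fst q'))) \<longleftrightarrow> B (fst q) = B (fst q0)"
    if "q \<in> ?G" for q
  proof (intro iffI ballI)
    assume "\<forall>q'\<in>?G. g (B (fst q)) \<le> g (B (fst q'))"
    with q0(1) have "g (B (fst q)) \<le> g (B (fst q0))"
      by (rule bspec[rotated])
    then show "B (fst q) = B (fst q0)"
      by (rule unique[OF that])
  next
    fix q'
    assume "B (fst q) = B (fst q0)" "q' \<in> ?G"
    then show "g (B (fst q)) \<le> g (B (fst q'))"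
      using q0(2) by metis
  qed
  then have "optimal_solutions (g \<circ> B) R\<^sub>X R\<^sub>Y A = {q \<in> ?G. B (fst q) = B (fst q0)}"
    unfolding opt by (rule Collect_cong[OF conj_cong[OF refl]])
  also have "\<dots> = {q \<in> F. B (fst q) = B (fst q0) \<and> K_op A q = 0}"
    by auto
  finally have eq: "optimal_solutions (g \<circ> B) R\<^sub>X R\<^sub>Y A
      = {q \<in> F. B (fst q) = B (fst q0) \<and> K_op A q = 0}" .
  have "q0 \<in> {q \<in> F. B (fst q) = B (fst q0) \<and> K_op A q = 0}"
    using q0(1) by simp
  then show thesis
    by (intro that[OF eq] notI) (simp only: empty_iff)
qed

section \<open>The quadratic gap\<close>

lemma arg_min_dist_closest_point:
  fixes P :: "'a::euclidean_space set"
  assumes "closed P" "convex P" "P \<noteq> {}"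
  shows "{p. is_arg_min (\<lambda>p. (norm (q - p))\<^sup>2) (\<lambda>p. p \<in> P) p} = {closest_point P q}"
proof -
  have "is_arg_min (\<lambda>p. (norm (q - p))\<^sup>2) (\<lambda>p. p \<in> P) p \<longleftrightarrow> p \<in> P \<and> (\<forall>z\<in>P. dist q p \<le> dist q z)"
    for p
    by (simp add: is_arg_min_linorder dist_norm Ball_def)
  with closest_point_unique[OF assms(2,1)] closest_point_exists[OF assms(1,3)] show ?thesis
    by auto
qed

theorem theorem2:
  fixes f :: "'a::euclidean_space \<Rightarrow> real"
    and R\<^sub>X :: "'a \<Rightarrow> ereal"
    and R\<^sub>Y :: "'b::euclidean_space \<Rightarrow> ereal"
    and A :: "'a \<Rightarrow> 'b"
    and B :: "'a \<Rightarrow> 'c::euclidean_space"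
    and g :: "'c \<Rightarrow> real"
    and C :: "'a \<times> 'b \<Rightarrow> real ^ 'p::finite"
    and b :: "real ^ 'p"
    and \<alpha>\<^sub>g \<beta> :: real
  assumes "convex_on UNIV f" and "smooth_with \<beta> f"
    and "proper R\<^sub>X" and "lower_semicontinuous R\<^sub>X" and "convex_ereal R\<^sub>X"
    and "proper R\<^sub>Y" and "lower_semicontinuous R\<^sub>Y" and "convex_ereal R\<^sub>Y"
    and "linear A"
    and "slater f R\<^sub>X R\<^sub>Y A"
    and "linear B" and "f = g \<circ> B"
    and "\<alpha>\<^sub>g > 0" and "strongly_convex \<alpha>\<^sub>g g"
    and "linear C" and "compact {q. C q \<le> b}"
    and "R_Q R\<^sub>X R\<^sub>Y = indicator_ereal {q. C q \<le> b}"
  shows "\<exists>\<sigma>>0. \<forall>\<rho>\<ge>\<alpha>\<^sub>g. has_saddle_point (aug_Lagrangian f R\<^sub>X R\<^sub>Y A \<rho>) \<longrightarrow>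
           PQG f R\<^sub>X R\<^sub>Y A \<rho> (\<alpha>\<^sub>g * inverse \<sigma>)"
proof -
  note A = \<open>linear A\<close> and B = \<open>linear B\<close> and C = \<open>linear C\<close>
  let ?F = "{q. C q \<le> b}" and ?P = "optimal_solutions f R\<^sub>X R\<^sub>Y A"
  let ?E = "\<lambda>q. (B (fst q), K_op A q)"
  have dom: "effective_domain (R_Q R\<^sub>X R\<^sub>Y) = ?F"
    unfolding \<open>R_Q R\<^sub>X R\<^sub>Y = _\<close> by (auto simp: effective_domain_def indicator_ereal_def)
  have deriv: "\<exists>D. GDERIV f x :> D" for x
    using \<open>smooth_with \<beta> f\<close> by (simp add: smooth_with_def)
  then have cont: "continuous_on UNIV f"
    unfolding continuous_on_eq_continuous_within gderiv_def
    using has_derivative_continuous has_derivative_at_withinI by blast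
  have "convex ?F"
    using convex_linear_vimage[OF C convex_atMost_vec] by (simp add: vimage_def)
  obtain x\<^sub>1 where "x\<^sub>1 \<in> effective_domain R\<^sub>X" "A x\<^sub>1 \<in> effective_domain R\<^sub>Y"
    using \<open>slater f R\<^sub>X R\<^sub>Y A\<close> rel_interior_subset
    unfolding slater_def by (metis IntD2 subsetD)
  then have q\<^sub>1: "(x\<^sub>1, A x\<^sub>1) \<in> ?F" "K_op A (x\<^sub>1, A x\<^sub>1) = 0"
    unfolding dom[symmetric] by (simp_all add: effective_domain_def R_Q_def K_op_def)
  obtain t where P_eq: "?P = {q \<in> ?F. B (fst q) = t \<and> K_op A q = 0}" and "?P \<noteq> {}"
    unfolding \<open>f = g \<circ> B\<close>
    by (rule optimal_solutions_eq_affine_slice[OF \<open>compact ?F\<close> \<open>convex ?F\<close> \<open>R_Q R\<^sub>X R\<^sub>Y = _\<close> A B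
        \<open>\<alpha>\<^sub>g > 0\<close> \<open>strongly_convex \<alpha>\<^sub>g g\<close> cont[unfolded \<open>f = g \<circ> B\<close>] q\<^sub>1]) simp
  have E: "linear ?E"
    using linear_K_op[OF A]
    by (intro linearI) (simp_all add: linear_add linear_scale B)
  have P_slice: "?P = ?F \<inter> ?E -` {(t, 0)}"
    unfolding P_eq by auto
  have "convex ?P"
    unfolding P_slice by (intro convex_Int \<open>convex ?F\<close> convex_linear_vimage[OF E]) simp
  have "closed ?P"
    unfolding P_slice using E \<open>compact ?F\<close>
    by (intro closed_Int closed_vimage) (auto simp: compact_imp_closed linear_continuous_on linear_linear)
  obtain \<kappa> where "\<kappa> > 0" and hoffman:
    "\<And>b e q p. C q \<le> b \<Longrightarrow> C p \<le> b \<Longrightarrow> ?E p = e \<Longrightarrow>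
      (\<And>z. C z \<le> b \<Longrightarrow> ?E z = e \<Longrightarrow> dist q p \<le> dist q z) \<Longrightarrow>
      norm (q - p) \<le> \<kappa> * norm (?E (q - p))"
    using hoffman_bound[OF C E] by metis
  have gap: "(q\<^sub>0 - q) \<bullet> grad (\<lambda>p. S_fun f A \<rho> p w) q
      \<le> S_fun f A \<rho> q\<^sub>0 w - S_fun f A \<rho> q w
        - \<alpha>\<^sub>g * inverse (\<kappa>\<^sup>2) / 2 * (norm (q\<^sub>0 - q))\<^sup>2"
    if "\<rho> \<ge> \<alpha>\<^sub>g" and q: "q \<in> ?F" and q\<^sub>0: "q\<^sub>0 = closest_point ?P q" for \<rho> q q\<^sub>0 w
  proof -
    let ?d = "q\<^sub>0 - q"
    have "q\<^sub>0 \<in> ?P" "\<And>z. z \<in> ?P \<Longrightarrow> dist q q\<^sub>0 \<le> dist q z"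
      using closest_point_exists[OF \<open>closed ?P\<close> \<open>?P \<noteq> {}\<close>, of q] unfolding q\<^sub>0 by auto
    then have "norm (q - q\<^sub>0) \<le> \<kappa> * norm (?E (q - q\<^sub>0))"
      using q by (intro hoffman[of q b q\<^sub>0 "(t, 0)"]) (auto simp: P_eq)
    moreover have "norm (?E (q - q\<^sub>0)) = norm (?E ?d)"
      using linear_diff[OF E, of q q\<^sub>0] linear_diff[OF E, of q\<^sub>0 q] norm_minus_commute by metis
    ultimately have "norm ?d \<le> \<kappa> * norm (?E ?d)"
      by (simp add: norm_minus_commute)
    then have "(norm ?d)\<^sup>2 \<le> \<kappa>\<^sup>2 * (norm (?E ?d))\<^sup>2"
      by (metis norm_ge_zero power_mono power_mult_distrib)
    also have "(norm (?E ?d))\<^sup>2 = (norm (B (fst ?d)))\<^sup>2 + (norm (K_op A ?d))\<^sup>2"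
      by (simp add: norm_Pair)
    finally have "inverse (\<kappa>\<^sup>2) * (norm ?d)\<^sup>2 \<le> (norm (B (fst ?d)))\<^sup>2 + (norm (K_op A ?d))\<^sup>2"
      using \<open>\<kappa> > 0\<close> by (simp add: field_simps)
    then have "\<alpha>\<^sub>g / 2 * (inverse (\<kappa>\<^sup>2) * (norm ?d)\<^sup>2)
        \<le> \<alpha>\<^sub>g / 2 * ((norm (B (fst ?d)))\<^sup>2 + (norm (K_op A ?d))\<^sup>2)"
      using \<open>\<alpha>\<^sub>g > 0\<close> by (intro mult_left_mono) auto
    moreover have "\<alpha>\<^sub>g / 2 * (norm (K_op A ?d))\<^sup>2 \<le> \<rho> / 2 * (norm (K_op A ?d))\<^sup>2"
      using \<open>\<rho> \<ge> \<alpha>\<^sub>g\<close> by (intro mult_right_mono) auto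
    moreover obtain D where D: "GDERIV f (fst q) :> D"
      using deriv by blast
    moreover have "f (fst q) + (fst q\<^sub>0 - fst q) \<bullet> D + \<alpha>\<^sub>g / 2 * (norm (B (fst ?d)))\<^sup>2 \<le> f (fst q\<^sub>0)"
      using strongly_convex_compose_gradient[OF \<open>strongly_convex \<alpha>\<^sub>g g\<close> B D[unfolded \<open>f = g \<circ> B\<close>]]
      by (simp add: \<open>f = g \<circ> B\<close>)
    ultimately show ?thesis
      using S_fun_linearisation_error[OF A D, of \<rho> q\<^sub>0 w] by (simp add: algebra_simps)
  qed
  have "PQG f R\<^sub>X R\<^sub>Y A \<rho> (\<alpha>\<^sub>g * inverse (\<kappa>\<^sup>2))" if "\<rho> \<ge> \<alpha>\<^sub>g" for \<rho>
    unfolding PQG_def dom arg_min_dist_closest_point[OF \<open>closed ?P\<close> \<open>convex ?P\<close> \<open>?P \<noteq> {}\<close>]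
    using gap[OF that] \<open>\<alpha>\<^sub>g > 0\<close> \<open>\<kappa> > 0\<close> by simp
  with \<open>\<kappa> > 0\<close> show ?thesis
    by (intro exI[of _ "\<kappa>\<^sup>2"]) simp
qed

end
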